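(* Let $p$ be an odd prime, let $e \ge 1$ be an integer, and let $g, c$ be fixed integers with $p \nmid g$ and $p \nmid c$. Let $m = \operatorname{ord}_p(g)$ and $f(x) = x g^x - c$. Then there are $m$ solutions $x_1, \dots, x_m \in \{1, \dots, p^e m \mid x \not\equiv 0 \pmod p\}$ to $f(x) \equiv 0 \pmod{p^e}$, and they satisfy $$\sum_{i=1}^{m} x_i \equiv 0 \pmod p,$$ and, if $m$ is odd, $$\sum_{i=1}^{m} x_i \equiv 0 \pmod m.$$
   Context: $\operatorname{ord}_p(g)$ denotes the multiplicative order of $g$ modulo $p$. The notation $\{1,\dots,N \mid x\not\equiv 0 \pmod p\}$ denotes the set of integers $x$ with $1 \le x \le N$ and $p \nmid x$.
   Formalization: The congruence of the sum modulo p is claimed only for m ≠ 1; for m = 1 (g ≡ 1 mod p) the single solution is ≡ c mod p, so the sum is never 0 mod p (e.g. p = 3, e = 1, g = c = 1 gives sum 1). *)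

theory Defs
  imports "HOL-Number_Theory.Number_Theory"
begin

definition f :: "int \<Rightarrow> int \<Rightarrow> nat \<Rightarrow> int" where
  "f g c x = int x * g ^ x - c"

definition solutions :: "nat \<Rightarrow> nat \<Rightarrow> int \<Rightarrow> int \<Rightarrow> nat set" where
  "solutions p e g c =
     {x \<in> {1..p ^ e * ord (int p) g}. \<not> [x = 0] (mod p) \<and> [f g c x = 0] (mod int (p ^ e))}"

end

theory Submission
  imports Defs
begin

text \<open>
  The map \<open>x \<mapsto> (x mod m, x g\<^sup>x mod p\<^sup>e)\<close> is injective on \<open>{1..p\<^sup>e m}\<close>: if \<open>x \<equiv> y\<close> modulo \<open>m p\<^sup>k\<close>,
  then \<open>g\<^sup>x \<equiv> g\<^sup>y\<close> modulo \<open>p\<^bsup>k+1\<^esup>\<close>, so \<open>x g\<^sup>x \<equiv> y g\<^sup>y\<close> forces \<open>x \<equiv> y\<close> modulo \<open>p\<^bsup>k+1\<^esup>\<close>. By counting it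
  is onto \<open>{..<m} \<times> {..<p\<^sup>e}\<close>, so the solutions hit every residue class modulo \<open>m\<close> exactly once.
  Modulo \<open>m\<close> their sum is therefore \<open>m (m - 1) / 2\<close>; modulo \<open>p\<close> the solution in the class of \<open>r\<close> is
  \<open>c g\<^bsup>-r\<^esup>\<close>, and the sum is a complete geometric sum.
\<close>

section \<open>Preliminaries on orders and on repeated \<open>p\<close>-th powers\<close>

lemma ord_int_eq_ord_nat:
  assumes "n > 0"
  shows "ord (int n) a = ord n (nat (a mod int n))"
proof -
  have a: "int (nat (a mod int n)) = a mod int n"
    using assms by simp
  have "coprime (int n) a \<longleftrightarrow> coprime (int n) (a mod int n)"
    using assms by simp
  also have "\<dots> \<longleftrightarrow> coprime n (nat (a mod int n))"
    by (metis a coprime_int_iff)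
  finally have cop: "coprime (int n) a \<longleftrightarrow> coprime n (nat (a mod int n))" .
  have "[a ^ d = 1] (mod int n) \<longleftrightarrow> [nat (a mod int n) ^ d = 1] (mod n)" for d
  proof -
    have "[a ^ d = 1] (mod int n) \<longleftrightarrow> [(a mod int n) ^ d = 1] (mod int n)"
      by (simp add: cong_def power_mod)
    also have "\<dots> \<longleftrightarrow> [int (nat (a mod int n) ^ d) = int 1] (mod int n)"
      by (simp only: of_nat_power a of_nat_1)
    finally show ?thesis
      by (simp only: cong_int_iff)
  qed
  with cop show ?thesis
    by (simp add: ord_def)
qed

text \<open>Each further \<open>p\<close>-th power gains one factor \<open>p\<close>: in
  \<open>b ^ p - 1 = (b - 1) * (\<Sum>i<p. b ^ i)\<close> every term of the sum is 1 modulo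
  \<open>p\<close>, so the sum is congruent to \<open>p\<close>, that is, to 0.\<close>

lemma cong_1_power_prime_power:
  fixes a :: int
  assumes "[a = 1] (mod int p)"
  shows "[a ^ (p ^ k) = 1] (mod int p ^ Suc k)"
proof (induction k)
  case 0
  then show ?case using assms by simp
next
  case (Suc k)
  define b where "b = a ^ (p ^ k)"
  have dvd: "int p ^ Suc k dvd b - 1"
    using Suc by (simp add: b_def cong_iff_dvd_diff)
  then have "[b = 1] (mod int p)"
    by (meson cong_iff_dvd_diff dvd_power dvd_trans zero_less_Suc)
  then have "[(\<Sum>i<p. b ^ i) = (\<Sum>i<p. 1 ^ i)] (mod int p)"
    by (intro cong_sum cong_pow)
  then have "int p dvd (\<Sum>i<p. b ^ i)"
    using cong_dvd_iff by fastforce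
  with dvd have "int p ^ Suc k * int p dvd (b - 1) * (\<Sum>i<p. b ^ i)"
    by (rule mult_dvd_mono)
  then have "int p ^ Suc (Suc k) dvd b ^ p - 1"
    by (simp only: power_diff_1_eq power_Suc2[of _ "Suc k"])
  moreover have "b ^ p = a ^ (p ^ Suc k)"
    unfolding b_def power_mult[symmetric] power_Suc2 ..
  ultimately show ?case
    by (simp only: cong_iff_dvd_diff)
qed

section \<open>The order of \<open>g\<close> modulo \<open>p\<close>, and lifting to powers of
  \<open>p\<close>\<close>

locale prime_ord =
  fixes p m :: nat and g :: int
  assumes prime_p: "prime p" and not_dvd: "\<not> int p dvd g"
    and m_eq: "m = ord (int p) g"
begin

lemma p_pos: "p > 0"
  using prime_p by (rule prime_gt_0_nat)

lemma coprime_g: "coprime (int p) g"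
  using prime_p not_dvd by (simp add: prime_imp_coprime)

text \<open>Moves the order to a natural base; the positivity of \<open>m\<close>,
  \<open>g_pow_m\<close>, \<open>g_cong_1\<close> and \<open>coprime_m\<close> are all read off from
  this form.\<close>

lemma m_ord_nat: "m = ord p (nat (g mod int p))"
  using m_eq ord_int_eq_ord_nat[OF p_pos] by simp

lemma int_nat_g: "int (nat (g mod int p)) = g mod int p"
  using p_pos by simp

lemma coprime_nat_g: "coprime p (nat (g mod int p))"
proof -
  have "coprime (int p) (int (nat (g mod int p)))"
    unfolding int_nat_g using p_pos coprime_g by simp
  then show ?thesis
    by (simp only: coprime_int_iff)
qed

lemma m_pos: "m > 0"
  using coprime_nat_g m_ord_nat by simp

lemma g_pow_m: "[g ^ m = 1] (mod int p)"
proof -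
  have "[int (nat (g mod int p) ^ m) = int 1] (mod int p)"
    unfolding cong_int_iff m_ord_nat by (rule ord)
  then have "[(g mod int p) ^ m = 1] (mod int p)"
    by (simp only: of_nat_power int_nat_g of_nat_1)
  then show ?thesis
    by (simp add: cong_def power_mod)
qed

lemma g_cong_1:
  assumes "[g = 1] (mod int p)"
  shows "m = 1"
proof -
  have "[int (nat (g mod int p)) = int 1] (mod int p)"
    unfolding int_nat_g using assms by (simp add: cong_def)
  then have "[nat (g mod int p) = 1] (mod p)"
    by (simp only: cong_int_iff)
  then show ?thesis
    by (simp add: m_ord_nat ord_eq_Suc_0_iff)
qed

text \<open>By Fermat \<open>m\<close> divides \<open>p - 1\<close>. This is what allows congruences
  modulo \<open>m\<close> and modulo powers of \<open>p\<close> to be combined.\<close>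

lemma coprime_m: "coprime m p"
proof -
  have "m dvd p - 1"
    using order_divides_totient[OF coprime_nat_g] prime_p
    by (simp add: m_ord_nat totient_prime)
  moreover have "coprime (p - 1) p"
    using p_pos by (metis Suc_diff_1 coprime_Suc_right_nat)
  ultimately show ?thesis
    by (rule coprime_divisors[OF _ dvd_refl])
qed

text \<open>The exponents differ by a multiple of \<open>m * p ^ k\<close>, and \<open>g ^ m\<close>
  is 1 modulo \<open>p\<close>, so its \<open>p ^ k\<close>-th power is 1 modulo
  \<open>p ^ Suc k\<close>. The gain of one factor \<open>p\<close> over the hypothesis drives the
  induction in \<open>x_pow_x_lift\<close>.\<close>

lemma pow_cong:
  assumes "[x = y] (mod m * p ^ k)"
  shows "[g ^ x = g ^ y] (mod int p ^ Suc k)"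
  using assms
proof (induction x y rule: linorder_wlog)
  case (le x y)
  then obtain q where q: "y = q * (m * p ^ k) + x"
    by (meson cong_le_nat cong_sym)
  have "[((g ^ m) ^ (p ^ k)) ^ q = 1 ^ q] (mod int p ^ Suc k)"
    by (intro cong_pow cong_1_power_prime_power g_pow_m)
  then have "[((g ^ m) ^ (p ^ k)) ^ q * g ^ x = 1 ^ q * g ^ x] (mod int p ^ Suc k)"
    by (rule cong_scalar_right)
  moreover have "((g ^ m) ^ (p ^ k)) ^ q * g ^ x = g ^ y"
    by (simp add: q power_add mult.commute flip: power_mult)
  ultimately show ?case
    by (simp add: cong_sym)
qed (simp add: cong_sym_eq)

lemma x_pow_x_lift:
  assumes "[x = y] (mod m)" "[int x * g ^ x = int y * g ^ y] (mod int p ^ e)" "k \<le> e"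
  shows "[x = y] (mod m * p ^ k)"
  using \<open>k \<le> e\<close>
proof (induction k)
  case 0
  then show ?case using assms by simp
next
  case (Suc k)
  have "[int y * g ^ x = int y * g ^ y] (mod int p ^ Suc k)"
    using Suc by (intro cong_scalar_left pow_cong) simp
  moreover have "[int x * g ^ x = int y * g ^ y] (mod int p ^ Suc k)"
    using assms(2) Suc.prems by (meson cong_dvd_modulus le_imp_power_dvd)
  ultimately have "[int x * g ^ x = int y * g ^ x] (mod int p ^ Suc k)"
    using cong_sym cong_trans by blast
  moreover have "coprime (g ^ x) (int p ^ Suc k)"
    using coprime_g by (simp add: coprime_commute)
  ultimately have "[int x = int y] (mod int (p ^ Suc k))"
    by (simp add: cong_mult_rcancel)
  then have "[x = y] (mod p ^ Suc k)"
    by (simp only: cong_int_iff)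
  moreover have "coprime m (p ^ Suc k)"
    using coprime_m by simp
  ultimately show ?case
    using assms(1) by (intro coprime_cong_mult_nat)
qed

section \<open>The bijection with pairs of residues, and its fibre over \<open>c\<close>\<close>

lemma bij_residues:
  "bij_betw (\<lambda>x. (x mod m, int x * g ^ x mod int p ^ e)) {1..p ^ e * m}
     ({..<m} \<times> {0..<int p ^ e})"
    (is "bij_betw ?h ?A ?B")
proof -
  have inj: "inj_on ?h ?A"
  proof (rule inj_onI)
    fix x y
    assume xy: "x \<in> ?A" "y \<in> ?A" and "?h x = ?h y"
    then have "[x = y] (mod m * p ^ e)"
      by (intro x_pow_x_lift[where e = e]) (auto simp: cong_def)
    \<comment> \<open>The range starts at 1, so both numbers are shifted down to become least
      residues.\<close>
    then have "[x - 1 = y - 1] (mod m * p ^ e)"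
      using xy by (intro cong_diff_nat) auto
    moreover have "x - 1 < m * p ^ e" "y - 1 < m * p ^ e"
      using xy by (auto simp: mult.commute)
    ultimately have "x - 1 = y - 1"
      by (rule cong_less_modulus_unique_nat)
    then show "x = y"
      using xy unfolding atLeastAtMost_iff by arith
  qed
  have "?h ` ?A = ?B"
  proof (rule card_subset_eq)
    show "?h ` ?A \<subseteq> ?B"
      using m_pos p_pos by auto
    have "nat (int p ^ e) = p ^ e"
      by (simp add: nat_power_eq)
    then show "card (?h ` ?A) = card ?B"
      using inj by (simp add: card_image card_cartesian_product)
  qed simp
  with inj show ?thesis
    by (simp add: bij_betw_def)
qed

text \<open>Since \<open>e \<ge> 1\<close>, the congruence also holds modulo \<open>p\<close>, and
  as \<open>p\<close> does not divide \<open>c\<close> it forces \<open>p\<close> not to divide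
  \<open>x\<close>. The solutions thus form a fibre of the second coordinate in
  \<open>bij_residues\<close>.\<close>

lemma solutions_eq:
  assumes "e \<ge> 1" "\<not> int p dvd c"
  shows "solutions p e g c =
    {x \<in> {1..p ^ e * m}. int x * g ^ x mod int p ^ e = c mod int p ^ e}"
proof -
  have "\<not> [x = 0] (mod p)" if "[int x * g ^ x = c] (mod int p ^ e)" for x
  proof
    assume "[x = 0] (mod p)"
    then have "int p dvd int x * g ^ x"
      by (simp add: cong_0_iff)
    moreover have "[int x * g ^ x = c] (mod int p)"
      using that assms(1) by (metis cong_dvd_modulus dvd_power not_one_le_zero zero_less_iff_neq_zero)
    ultimately show False
      using assms(2) cong_dvd_iff by blast
  qed
  then show ?thesis
    unfolding solutions_def f_def m_eq by (auto simp: cong_diff_iff_cong_0 cong_def[of _ c])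
qed

text \<open>Restricts \<open>bij_residues\<close> to the fibre over \<open>c\<close> and drops the
  constant second coordinate. The count and the reindexing of both sums come from here.\<close>

lemma bij_solutions:
  assumes "e \<ge> 1" "\<not> int p dvd c"
  shows "bij_betw (\<lambda>x. x mod m) (solutions p e g c) {..<m}"
proof -
  let ?h = "\<lambda>x. (x mod m, int x * g ^ x mod int p ^ e)"
  let ?S = "solutions p e g c" and ?c = "c mod int p ^ e"
  have c: "?c \<in> {0..<int p ^ e}"
    using p_pos by simp
  have "?h ` ?S = {..<m} \<times> {?c}"
  proof
    show "?h ` ?S \<subseteq> {..<m} \<times> {?c}"
      using m_pos by (auto simp: solutions_eq[OF assms])
    show "{..<m} \<times> {?c} \<subseteq> ?h ` ?S"
    proof
      fix z assume z: "z \<in> {..<m} \<times> {?c}"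
      then have "z \<in> ?h ` {1..p ^ e * m}"
        using c bij_betw_imp_surj_on[OF bij_residues[of e]] by auto
      with z show "z \<in> ?h ` ?S"
        by (auto simp: solutions_eq[OF assms])
    qed
  qed
  moreover have "?S \<subseteq> {1..p ^ e * m}"
    by (auto simp: solutions_eq[OF assms])
  ultimately have "bij_betw ?h ?S ({..<m} \<times> {?c})"
    using bij_betw_subset[OF bij_residues] by blast
  moreover have "bij_betw fst ({..<m} \<times> {?c}) {..<m}"
    by (auto simp: bij_betw_def inj_on_def)
  ultimately have "bij_betw (fst \<circ> ?h) ?S {..<m}"
    by (rule bij_betw_trans)
  then show ?thesis
    by (simp add: comp_def)
qed

section \<open>Solutions modulo \<open>p\<close>, and the two sums\<close>

lemma solution_cong:
  assumes "e \<ge> 1" "\<not> int p dvd c" "x \<in> solutions p e g c"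
  shows "[int x = c * g ^ (m - x mod m)] (mod int p)"
proof -
  have "[int x * g ^ x = c] (mod int p ^ e)"
    using assms by (simp add: solutions_eq cong_def)
  then have c: "[int x * g ^ x = c] (mod int p)"
    using assms(1) by (metis cong_dvd_modulus dvd_power not_one_le_zero zero_less_iff_neq_zero)
  \<comment> \<open>The factor \<open>g ^ (m - x mod m)\<close> serves as the inverse of
    \<open>g ^ x\<close> modulo \<open>p\<close> with a natural exponent: the two exponents add up
    to a multiple of \<open>m\<close>.\<close>
  have "x + (m - x mod m) = m * Suc (x div m)"
  proof -
    have "x mod m \<le> m"
      using m_pos by (simp add: less_imp_le)
    moreover have "x = m * (x div m) + x mod m"
      by simp
    ultimately show ?thesis
      unfolding mult_Suc_right by linarith
  qed
  then have "g ^ x * g ^ (m - x mod m) = (g ^ m) ^ Suc (x div m)"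
    by (metis power_add power_mult)
  moreover have "[(g ^ m) ^ Suc (x div m) = 1 ^ Suc (x div m)] (mod int p)"
    by (intro cong_pow g_pow_m)
  ultimately have "[int x * (g ^ x * g ^ (m - x mod m)) = int x * 1] (mod int p)"
    by (intro cong_scalar_left) simp
  moreover have "[int x * g ^ x * g ^ (m - x mod m) = c * g ^ (m - x mod m)] (mod int p)"
    by (intro cong_scalar_right c)
  ultimately show ?thesis
    by (metis cong_sym cong_trans mult.assoc mult.right_neutral)
qed

text \<open>The geometric sum times \<open>g - 1\<close> is \<open>g ^ m - 1\<close>, which
  \<open>p\<close> divides; \<open>m \<noteq> 1\<close> makes \<open>g - 1\<close> invertible modulo
  \<open>p\<close>. For \<open>m = 1\<close> the only solution is congruent to \<open>c\<close>, so
  the sum is not 0 modulo \<open>p\<close>.\<close>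

lemma sum_solutions_mod_p:
  assumes "e \<ge> 1" "\<not> int p dvd c" "m \<noteq> 1"
  shows "[(\<Sum>x\<in>solutions p e g c. x) = 0] (mod p)"
proof -
  let ?S = "solutions p e g c"
  have "[(\<Sum>x\<in>?S. int x) = (\<Sum>x\<in>?S. c * g ^ (m - x mod m))] (mod int p)"
    using assms by (intro cong_sum solution_cong)
  also have "(\<Sum>x\<in>?S. c * g ^ (m - x mod m)) = (\<Sum>r<m. c * g ^ (m - r))"
    by (rule sum.reindex_bij_betw[OF bij_solutions[OF assms(1,2)]])
  \<comment> \<open>Reversing the order of summation sends \<open>r\<close> to
    \<open>m - Suc r\<close>, so the exponent \<open>m - r\<close> becomes
    \<open>Suc r\<close>.\<close>
  also have "\<dots> = (\<Sum>r<m. c * g ^ Suc r)"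
    by (subst sum.nat_diff_reindex[symmetric]) (auto intro!: sum.cong)
  also have "\<dots> = c * g * (\<Sum>r<m. g ^ r)"
    by (simp add: sum_distrib_left mult.assoc)
  finally have sum: "[(\<Sum>x\<in>?S. int x) = c * g * (\<Sum>r<m. g ^ r)] (mod int p)" .
  have "int p dvd (g - 1) * (\<Sum>r<m. g ^ r)"
    using g_pow_m by (simp add: cong_iff_dvd_diff power_diff_1_eq)
  moreover have "\<not> int p dvd g - 1"
    using g_cong_1 assms(3) by (auto simp: cong_iff_dvd_diff)
  ultimately have "int p dvd (\<Sum>r<m. g ^ r)"
    using prime_p by (simp add: prime_dvd_mult_iff)
  then have "int p dvd (\<Sum>x\<in>?S. int x)"
    using cong_dvd_iff[OF sum] by simp
  then have "int p dvd int (\<Sum>x\<in>?S. x)"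
    by simp
  then show ?thesis
    unfolding int_dvd_int_iff cong_0_iff .
qed

lemma sum_solutions_mod_m:
  assumes "e \<ge> 1" "\<not> int p dvd c" "odd m"
  shows "[(\<Sum>x\<in>solutions p e g c. x) = 0] (mod m)"
proof -
  let ?S = "solutions p e g c"
  have "[(\<Sum>x\<in>?S. x) = (\<Sum>x\<in>?S. x mod m)] (mod m)"
    by (intro cong_sum) (simp add: cong_def)
  also have "(\<Sum>x\<in>?S. x mod m) = (\<Sum>r<m. r)"
    by (rule sum.reindex_bij_betw[OF bij_solutions[OF assms(1,2)]])
  also have "\<dots> = m * ((m - 1) div 2)"
  proof -
    have "(\<Sum>r<m. r) = m * (m - 1) div 2"
      by (simp add: Sum_Ico_nat flip: atLeast0LessThan)
    \<comment> \<open>For odd \<open>m\<close> the factor \<open>m - 1\<close> is even and absorbs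
      the division by 2, leaving \<open>m\<close> as a divisor.\<close>
    also have "\<dots> = m * ((m - 1) div 2)"
      using assms(3) by (simp add: div_mult_swap)
    finally show ?thesis .
  qed
  also have "[\<dots> = 0] (mod m)"
    by (simp add: cong_0_iff)
  finally show ?thesis .
qed

end

theorem theorem12:
  fixes p e m :: nat and g c :: int
  assumes "prime p" and "odd p" and "e \<ge> 1"
    and "\<not> int p dvd g" and "\<not> int p dvd c"
    and "m = ord (int p) g"
  shows "card (solutions p e g c) = m \<and>
         (m \<noteq> 1 \<longrightarrow> [(\<Sum>x\<in>solutions p e g c. x) = 0] (mod p)) \<and>
         (odd m \<longrightarrow> [(\<Sum>x\<in>solutions p e g c. x) = 0] (mod m))"
proof -
  interpret prime_ord p m g
    using assms by unfold_locales
  have "card (solutions p e g c) = m"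
    using bij_betw_same_card[OF bij_solutions] assms by fastforce
  then show ?thesis
    using assms sum_solutions_mod_p sum_solutions_mod_m by blast
qed

end
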